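(* Let $m\geq 1$, $k\geq 1$, $b\geq 2$ be integers, let $\Theta=\{\underline{\theta}_1,\ldots,\underline{\theta}_k\}$ with arbitrary $\underline{\theta}_s\in\mathbb{R}^m$, and let $\mathcal{T}$ be any countable union of affine hyperplanes in $\mathbb{R}^m$. For every $w\in[0,1)$, \[ \dim_P\Big(\bigcap_{\underline{\theta}\in\Theta}\mathcal{S}_{m,\underline{\theta}}(w)\setminus\mathcal{T}\Big)\ \geq\ \dim_P\Big(\bigcap_{\underline{\theta}\in\Theta}\mathcal{S}^{(b)}_{m,\underline{\theta}}(w)\setminus\mathcal{T}\Big)\ \geq\ (1-kew)m, \] where $e$ is Euler's number. In particular, if $k<m/e$, then for every such $\Theta$, \[ \dim_P\Big(\bigcap_{\underline{\theta}\in\Theta}\mathcal{S}_{m,\underline{\theta}}(1/m)\setminus\mathcal{T}\Big)\ \geq\ \dim_P\Big(\bigcap_{\underline{\theta}\in\Theta}\mathcal{S}^{(b)}_{m,\underline{\theta}}(1/m)\setminus\mathcal{T}\Big)>0 . \]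
   Context: Fix an arbitrary norm $\Vert\cdot\Vert$ on $\mathbb{R}^m$. For $\underline{\theta}\in\mathbb{R}^m$ and $w\geq 0$, $\mathcal{S}_{m,\underline{\theta}}(w)$ is the set of $\underline{x}\in\mathbb{R}^m$ such that for every $c>0$ there is $Q_0$ such that for all $Q\geq Q_0$ the system $1\leq q\leq Q$, $\Vert q\underline{x}-\underline{p}-\underline{\theta}\Vert\leq cQ^{-w}$ has a solution in integers $q\in\mathbb{Z}$, $\underline{p}\in\mathbb{Z}^m$. The $b$-ary set $\mathcal{S}^{(b)}_{m,\underline{\theta}}(w)$ is defined the same way except that $q$ is restricted to powers $q=b^N$ with $N$ a positive integer. $\dim_P$ denotes packing dimension. *)

theory Defs
  imports "HOL-Analysis.Analysis"
begin

section \<open>Packing dimension\<close>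

text \<open>A packing is encoded by its set of pairs (centre, radius); a ball of radius \<open>r\<close> contributes
  \<open>(2 r) powr s\<close>, which on Euclidean space is the \<open>s\<close>-th power of its diameter. Radii are positive,
  so for \<open>s = 0\<close> every ball contributes \<open>1\<close>.\<close>

definition packings :: "real \<Rightarrow> 'a::metric_space set \<Rightarrow> ('a \<times> real) set set" where
  "packings \<delta> A = {B. countable B \<and> (\<forall>(x, r)\<in>B. x \<in> A \<and> 0 < r \<and> r \<le> \<delta>) \<and>
                      disjoint_family_on (\<lambda>(x, r). cball x r) B}"

definition packing_premeasure_at :: "real \<Rightarrow> real \<Rightarrow> 'a::metric_space set \<Rightarrow> ennreal" where
  "packing_premeasure_at s \<delta> A =
     (SUP B\<in>packings \<delta> A. \<Sum>\<^sub>\<infinity>(x, r)\<in>B. ennreal ((2 * r) powr s))"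

text \<open>The infimum is the limit as \<open>\<delta>\<close> tends to \<open>0\<close>, by monotonicity in \<open>\<delta>\<close>.\<close>

definition packing_premeasure :: "real \<Rightarrow> 'a::metric_space set \<Rightarrow> ennreal" where
  "packing_premeasure s A = (INF \<delta>\<in>{0<..}. packing_premeasure_at s \<delta> A)"

definition packing_measure :: "real \<Rightarrow> 'a::metric_space set \<Rightarrow> ennreal" where
  "packing_measure s A =
     (INF C\<in>{C :: nat \<Rightarrow> 'a set. A \<subseteq> (\<Union>i. C i)}. \<Sum>i. packing_premeasure s (C i))"

text \<open>With this convention the empty set has dimension \<open>0\<close>.\<close>

definition packing_dim :: "'a::metric_space set \<Rightarrow> ereal" where
  "packing_dim A = (INF s\<in>{s. 0 \<le> s \<and> packing_measure s A = 0}. ereal s)"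


section \<open>Inhomogeneous uniform approximation\<close>

definition is_norm :: "('a::real_vector \<Rightarrow> real) \<Rightarrow> bool" where
  "is_norm N \<longleftrightarrow> (\<forall>x. N x \<ge> 0) \<and> (\<forall>x. N x = 0 \<longleftrightarrow> x = 0) \<and>
     (\<forall>a x. N (a *\<^sub>R x) = \<bar>a\<bar> * N x) \<and> (\<forall>x y. N (x + y) \<le> N x + N y)"

text \<open>\<open>D\<close> is the set of admissible denominators. The parameter \<open>Q\<close> is real; the condition
  \<open>1 \<le> q \<le> Q\<close> forces \<open>Q0 \<ge> 1\<close>, so \<open>Q powr (- w)\<close> is only relevant at positive \<open>Q\<close>.\<close>

definition approx_set ::
    "(real^'m \<Rightarrow> real) \<Rightarrow> int set \<Rightarrow> real^'m \<Rightarrow> real \<Rightarrow> (real^'m) set" where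
  "approx_set N D \<theta> w =
     {x. \<forall>c>0. \<exists>Q0::real. \<forall>Q\<ge>Q0. \<exists>q\<in>D. \<exists>p :: int^'m.
           1 \<le> q \<and> of_int q \<le> Q \<and>
           N (of_int q *\<^sub>R x - (\<chi> i. of_int (p $ i)) - \<theta>) \<le> c * Q powr (- w)}"

definition sing_set :: "(real^'m \<Rightarrow> real) \<Rightarrow> real^'m \<Rightarrow> real \<Rightarrow> (real^'m) set" where
  "sing_set N \<theta> w = approx_set N UNIV \<theta> w"

definition sing_set_base ::
    "(real^'m \<Rightarrow> real) \<Rightarrow> nat \<Rightarrow> real^'m \<Rightarrow> real \<Rightarrow> (real^'m) set" where
  "sing_set_base N b \<theta> w = approx_set N {int b ^ n |n. n \<ge> 1} \<theta> w"

definition affine_hyperplane :: "'a::real_inner set \<Rightarrow> bool" where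
  "affine_hyperplane H \<longleftrightarrow> (\<exists>a \<beta>. a \<noteq> 0 \<and> H = {x. a \<bullet> x = \<beta>})"

end

theory Submission
  imports Defs
begin

text \<open>Group the base \<open>b\<close> digits of \<open>x\<close> into consecutive blocks, in periods of \<open>k + 1\<close>. In every period
  the first \<open>k\<close> blocks copy the leading digits of \<open>\<theta>\<^sub>1, \<dots>, \<theta>\<^sub>k\<close>, and the last block is free. If the
  \<open>j\<close>-th period starts at position \<open>\<rho> ^ j\<close> and a copying block starting at position \<open>p\<close> has length
  \<open>p / k\<close>, then the next chance to approximate the same \<open>\<theta>\<^sub>s\<close> comes at position \<open>\<rho> p\<close>, so \<open>x\<close> is
  approximated with exponent \<open>1 / (k \<rho>)\<close>; taking \<open>\<rho> = 1 / (k w')\<close> with \<open>w'\<close> slightly above \<open>w\<close> suffices.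
  The copying blocks of period \<open>j\<close> end at position \<open>\<rho> ^ j (1 + 1 / k) ^ k \<le> e \<rho> ^ j\<close>, so at the end of
  the free block a proportion of at least \<open>1 - e / \<rho> = 1 - k e w'\<close> of all digits is free. Packing dimension
  only sees these best scales. By Baire's argument, one member of any countable cover of the set (with the
  hyperplanes adjoined) is dense in some cylinder; a cylinder is not contained in a hyperplane, and
  its free blocks supply packings of arbitrarily large premeasure.\<close>


section \<open>Packing dimension\<close>

lemma packing_measure_mono: "A \<subseteq> B \<Longrightarrow> packing_measure s A \<le> packing_measure s B"
  unfolding packing_measure_def by (rule INF_superset_mono) auto

lemma packing_dim_mono:
  assumes "A \<subseteq> B"
  shows "packing_dim A \<le> packing_dim B"
  unfolding packing_dim_def
  using packing_measure_mono[OF assms] by (intro INF_superset_mono) (auto, metis le_zero_eq)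

lemma packing_dim_ge:
  assumes "\<And>s. \<lbrakk>0 \<le> s; s < d\<rbrakk> \<Longrightarrow> packing_measure s A \<noteq> 0"
  shows "ereal d \<le> packing_dim A"
  unfolding packing_dim_def
proof (rule INF_greatest)
  fix s :: real
  assume "s \<in> {s. 0 \<le> s \<and> packing_measure s A = 0}"
  then show "ereal d \<le> ereal s" using assms[of s] by (force simp: not_less)
qed

text \<open>Each \<open>f u\<close> is moved into \<open>C\<close> by less than \<open>r\<close>,
  which keeps the new centres more than \<open>2 * r\<close> apart, so the balls of radius
  \<open>r\<close> around them are disjoint. Asking only for points of the closure is what makes a
  Baire argument with closed sets usable.\<close>

lemma packing_premeasure_at_ge:
  fixes f :: "'i \<Rightarrow> 'a::metric_space" and C :: "'a set"
  assumes "finite I" and "0 < r" and "r \<le> \<delta>" and "0 \<le> s"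
    and dense: "\<And>u. u \<in> I \<Longrightarrow> f u \<in> closure C"
    and sep: "\<And>u u'. \<lbrakk>u \<in> I; u' \<in> I; u \<noteq> u'\<rbrakk> \<Longrightarrow> 4 * r \<le> dist (f u) (f u')"
  shows "ennreal (real (card I) * (2 * r) powr s) \<le> packing_premeasure_at s \<delta> C"
proof -
  have "\<exists>c\<in>C. dist c (f u) < r" if "u \<in> I" for u
    using dense[OF that] \<open>0 < r\<close> by (simp add: closure_approachable)
  then obtain c where cC: "\<And>u. u \<in> I \<Longrightarrow> c u \<in> C" and cd: "\<And>u. u \<in> I \<Longrightarrow> dist (c u) (f u) < r"
    by metis
  have disj: "cball (c u) r \<inter> cball (c u') r = {}" if u: "u \<in> I" "u' \<in> I" "u \<noteq> u'" for u u'
  proof (rule ccontr)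
    assume "cball (c u) r \<inter> cball (c u') r \<noteq> {}"
    then obtain z where "dist (c u) z \<le> r" "dist (c u') z \<le> r" by auto
    then have "dist (f u) (f u') < 4 * r"
      using cd[OF u(1)] cd[OF u(2)] dist_triangle[of "f u" "f u'" "c u"]
        dist_triangle[of "c u" "f u'" "c u'"] dist_triangle2[of "c u" "c u'" z]
      by (simp add: dist_commute)
    then show False using sep[OF u] by simp
  qed
  \<comment> \<open>A packing is a set of pairs, so coinciding centres would be counted once;
    disjointness excludes this because each ball contains its centre.\<close>
  have inj: "inj_on (\<lambda>u. (c u, r)) I"
  proof (rule inj_onI, rule ccontr)
    fix u u' assume *: "u \<in> I" "u' \<in> I" "(c u, r) = (c u', r)" "u \<noteq> u'"
    then show False using disj[of u u'] \<open>0 < r\<close> by auto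
  qed
  let ?B = "(\<lambda>u. (c u, r)) ` I"
  have "?B \<in> packings \<delta> C"
    unfolding packings_def disjoint_family_on_def
    using assms(1-3) cC disj by (auto intro: countable_finite)
  then have "(\<Sum>\<^sub>\<infinity>(x, r)\<in>?B. ennreal ((2 * r) powr s)) \<le> packing_premeasure_at s \<delta> C"
    unfolding packing_premeasure_at_def by (rule SUP_upper)
  also have "(\<Sum>\<^sub>\<infinity>(x, r)\<in>?B. ennreal ((2 * r) powr s)) = (\<Sum>u\<in>I. ennreal ((2 * r) powr s))"
    using \<open>finite I\<close> by (simp add: sum.reindex[OF inj])
  also have "\<dots> = ennreal (real (card I) * (2 * r) powr s)"
    by (simp add: ennreal_mult ennreal_of_nat_eq_real_of_nat)
  finally show ?thesis .
qed


section \<open>Expansions in blocks of digits\<close>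

text \<open>The digits in base \<open>b\<close> at the positions \<open>e t + 1, \<dots>, e (Suc t)\<close> are grouped into the
  single integer \<open>v t\<close>.\<close>

definition block_sum :: "nat \<Rightarrow> (nat \<Rightarrow> nat) \<Rightarrow> (nat \<Rightarrow> nat) \<Rightarrow> real" where
  "block_sum b e v = (\<Sum>t. real (v t) / real b ^ e (Suc t))"

text \<open>Since \<open>v t\<close> is at most \<open>b ^ (e (Suc t) - e t) - 1\<close>, the series
  is dominated by a telescoping one.\<close>

lemma block_sum_bounds:
  fixes b :: nat and e v :: "nat \<Rightarrow> nat"
  assumes "b \<ge> 1" and "\<And>t. e t \<le> e (Suc t)" and "\<And>t. v t < b ^ (e (Suc t) - e t)"
  shows "summable (\<lambda>t. real (v t) / real b ^ e (Suc t))"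
    and "0 \<le> block_sum b e v" and "block_sum b e v \<le> 1 / real b ^ e 0"
proof -
  have step: "real (v t) / real b ^ e (Suc t) \<le> 1 / real b ^ e t - 1 / real b ^ e (Suc t)" for t
  proof -
    have "real (v t) + 1 \<le> real b ^ (e (Suc t) - e t)"
      using assms(3)[of t] by (metis Suc_eq_plus1 Suc_leI of_nat_Suc of_nat_le_iff of_nat_power add.commute)
    moreover have "real b ^ e (Suc t) = real b ^ (e (Suc t) - e t) * real b ^ e t"
      using assms(2)[of t] by (simp add: power_add[symmetric])
    ultimately show ?thesis
      using \<open>b \<ge> 1\<close> by (simp add: field_simps)
  qed
  have part: "(\<Sum>t<n. real (v t) / real b ^ e (Suc t)) \<le> 1 / real b ^ e 0" for n
  proof -
    have "(\<Sum>t<n. real (v t) / real b ^ e (Suc t)) \<le> (\<Sum>t<n. 1 / real b ^ e t - 1 / real b ^ e (Suc t))"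
      by (intro sum_mono step)
    also have "\<dots> = 1 / real b ^ e 0 - 1 / real b ^ e n" by (rule sum_lessThan_telescope')
    finally show ?thesis by (smt (verit) of_nat_0_le_iff zero_le_divide_1_iff zero_le_power)
  qed
  show s: "summable (\<lambda>t. real (v t) / real b ^ e (Suc t))"
    by (rule summableI_nonneg_bounded[OF _ part]) simp
  show "0 \<le> block_sum b e v" unfolding block_sum_def by (intro suminf_nonneg s) simp
  show "block_sum b e v \<le> 1 / real b ^ e 0"
    unfolding block_sum_def by (rule suminf_le_const[OF s part])
qed

lemma block_sum_split:
  fixes b :: nat and e v :: "nat \<Rightarrow> nat"
  assumes "b \<ge> 1" and "\<And>t. e t \<le> e (Suc t)" and "\<And>t. v t < b ^ (e (Suc t) - e t)"
  shows "block_sum b e v = (\<Sum>t<n. real (v t) / real b ^ e (Suc t))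
           + block_sum b (\<lambda>t. e (t + n)) (\<lambda>t. v (t + n))"
  unfolding block_sum_def
  using suminf_split_initial_segment[OF block_sum_bounds(1)[of b e v, OF assms], of n] by simp

lemma block_sum_agree:
  fixes b :: nat and e v v' :: "nat \<Rightarrow> nat"
  assumes "b \<ge> 1" and "\<And>t. e t \<le> e (Suc t)"
    and "\<And>t. v t < b ^ (e (Suc t) - e t)" and "\<And>t. v' t < b ^ (e (Suc t) - e t)"
    and "\<And>t. t < n \<Longrightarrow> v t = v' t"
  shows "\<bar>block_sum b e v - block_sum b e v'\<bar> \<le> 1 / real b ^ e n"
proof -
  let ?T = "\<lambda>v. block_sum b (\<lambda>t. e (t + n)) (\<lambda>t. v (t + n))"
  have "0 \<le> ?T v" "?T v \<le> 1 / real b ^ e n" "0 \<le> ?T v'" "?T v' \<le> 1 / real b ^ e n"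
    using block_sum_bounds(2,3)[of b "\<lambda>t. e (t + n)" "\<lambda>t. v (t + n)"]
      block_sum_bounds(2,3)[of b "\<lambda>t. e (t + n)" "\<lambda>t. v' (t + n)"] assms(1-4) by simp_all
  moreover have "block_sum b e v - block_sum b e v' = ?T v - ?T v'"
    using block_sum_split[of b e v n] block_sum_split[of b e v' n] assms by simp
  ultimately show ?thesis by linarith
qed

text \<open>Only the term of index \<open>n\<close> depends on \<open>u\<close>. A free block thus
  yields translates of one base point by a grid of mesh \<open>1 / b ^ e (Suc n)\<close>, exact
  enough both for separation and for linear algebra.\<close>

lemma block_sum_update:
  fixes b :: nat and e v :: "nat \<Rightarrow> nat"
  assumes "b \<ge> 1" and "\<And>t. e t \<le> e (Suc t)" and "\<And>t. v t < b ^ (e (Suc t) - e t)"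
    and "u < b ^ (e (Suc n) - e n)"
  shows "block_sum b e (v(n := u)) = block_sum b e (v(n := 0)) + real u / real b ^ e (Suc n)"
proof -
  have "block_sum b e (v(n := u)) = (\<Sum>t<Suc n. real ((v(n := u)) t) / real b ^ e (Suc t))
           + block_sum b (\<lambda>t. e (t + Suc n)) (\<lambda>t. v (t + Suc n))"
    if "u < b ^ (e (Suc n) - e n)" for u
    using block_sum_split[of b e "v(n := u)" "Suc n"] assms(1-3) that by simp
  from this[of u] this[of 0] show ?thesis using assms(1,4) by simp
qed

text \<open>Multiplication by \<open>b ^ e n\<close> turns the first \<open>n\<close> blocks into an
  integer and brings the block copied from \<open>x\<close> to the front. Truncating
  \<open>x\<close> and dropping the tail give errors of opposite sign, each at most
  \<open>1 / b ^ (e (Suc n) - e n)\<close>, so the bound has no factor 2.\<close>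

lemma block_sum_approx:
  fixes b :: nat and e v :: "nat \<Rightarrow> nat" and x :: real
  assumes "b \<ge> 1" and "\<And>t. e t \<le> e (Suc t)" and "\<And>t. v t < b ^ (e (Suc t) - e t)"
    and "v n = nat \<lfloor>frac x * real b ^ (e (Suc n) - e n)\<rfloor>"
  shows "\<exists>p::int. \<bar>real b ^ e n * block_sum b e v - of_int p - x\<bar> \<le> 1 / real b ^ (e (Suc n) - e n)"
proof -
  define L where "L = e (Suc n) - e n"
  define y where "y = block_sum b (\<lambda>t. e (t + Suc n)) (\<lambda>t. v (t + Suc n))"
  have y: "0 \<le> y" "y \<le> 1 / real b ^ e (Suc n)"
    using block_sum_bounds(2,3)[of b "\<lambda>t. e (t + Suc n)" "\<lambda>t. v (t + Suc n)"] assms(1-3)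
    by (auto simp: y_def)
  have mono: "mono e" using assms(2) by (simp add: mono_iff_le_Suc)
  have bp: "real b > 0" using \<open>b \<ge> 1\<close> by simp
  have eS: "real b ^ e (Suc n) = real b ^ e n * real b ^ L"
    using assms(2)[of n] by (simp add: L_def power_add[symmetric])
  define z where "z = (\<Sum>t<n. int (v t) * int b ^ (e n - e (Suc t)))"
  have z: "real b ^ e n * (\<Sum>t<n. real (v t) / real b ^ e (Suc t)) = of_int z"
    unfolding z_def sum_distrib_left of_int_sum
  proof (rule sum.cong)
    fix t assume "t \<in> {..<n}"
    then have "e (Suc t) \<le> e n" using monoD[OF mono] by simp
    then have "real b ^ e n = real b ^ (e n - e (Suc t)) * real b ^ e (Suc t)"
      by (simp add: power_add[symmetric])
    then show "real b ^ e n * (real (v t) / real b ^ e (Suc t)) = of_int (int (v t) * int b ^ (e n - e (Suc t)))"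
      using bp by simp
  qed simp
  have "real b ^ e n * block_sum b e v = of_int z + real (v n) / real b ^ L + real b ^ e n * y"
    using block_sum_split[of b e v "Suc n", OF assms(1-3)] bp
    by (simp add: y_def distrib_left z[symmetric] eS)
  moreover have "0 \<le> real b ^ e n * y" "real b ^ e n * y \<le> 1 / real b ^ L"
    using y bp by (auto simp: eS field_simps)
  moreover have "real (v n) / real b ^ L \<le> frac x" "frac x \<le> real (v n) / real b ^ L + 1 / real b ^ L"
  proof -
    have "0 \<le> frac x * real b ^ L" by simp
    then have "real (v n) \<le> frac x * real b ^ L" "frac x * real b ^ L \<le> real (v n) + 1"
      unfolding assms(4) L_def by linarith+
    then show "real (v n) / real b ^ L \<le> frac x" "frac x \<le> real (v n) / real b ^ L + 1 / real b ^ L"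
      using bp by (auto simp: field_simps)
  qed
  ultimately have "\<bar>real b ^ e n * block_sum b e v - of_int (z - \<lfloor>x\<rfloor>) - x\<bar> \<le> 1 / real b ^ L"
    unfolding frac_def by simp
  then show ?thesis unfolding L_def by blast
qed

definition block_vec :: "nat \<Rightarrow> (nat \<Rightarrow> nat) \<Rightarrow> (nat \<Rightarrow> 'm \<Rightarrow> nat) \<Rightarrow> real^'m" where
  "block_vec b e v = (\<chi> i. block_sum b e (\<lambda>t. v t i))"

lemma block_vec_agree:
  fixes v v' :: "nat \<Rightarrow> 'm::finite \<Rightarrow> nat"
  assumes "b \<ge> 1" and "\<And>t. e t \<le> e (Suc t)"
    and "\<And>t i. v t i < b ^ (e (Suc t) - e t)" and "\<And>t i. v' t i < b ^ (e (Suc t) - e t)"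
    and "\<And>t. t < n \<Longrightarrow> v t = v' t"
  shows "dist (block_vec b e v) (block_vec b e v') \<le> real CARD('m) / real b ^ e n"
proof -
  have "dist (block_vec b e v) (block_vec b e v')
      \<le> (\<Sum>i\<in>UNIV. \<bar>(block_vec b e v - block_vec b e v') $ i\<bar>)"
    unfolding dist_norm by (rule norm_le_l1_cart)
  also have "\<dots> \<le> (\<Sum>i\<in>(UNIV::'m set). 1 / real b ^ e n)"
  proof (rule sum_mono)
    fix i :: 'm
    show "\<bar>(block_vec b e v - block_vec b e v') $ i\<bar> \<le> 1 / real b ^ e n"
      using block_sum_agree[of b e "\<lambda>t. v t i" "\<lambda>t. v' t i" n] assms by (simp add: block_vec_def)
  qed
  finally show ?thesis by simp
qed

lemma block_vec_update:
  fixes v :: "nat \<Rightarrow> 'm::finite \<Rightarrow> nat"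
  assumes "b \<ge> 1" and "\<And>t. e t \<le> e (Suc t)" and "\<And>t i. v t i < b ^ (e (Suc t) - e t)"
    and "\<And>i. u i < b ^ (e (Suc n) - e n)"
  shows "block_vec b e (v(n := u)) = block_vec b e (v(n := \<lambda>_. 0)) + (\<chi> i. real (u i) / real b ^ e (Suc n))"
proof -
  have eq: "(\<lambda>t. (v(n := u)) t i) = (\<lambda>t. v t i)(n := u i)" for u :: "'m \<Rightarrow> nat" and i
    by auto
  show ?thesis
    unfolding vec_eq_iff block_vec_def vector_add_component vec_lambda_beta eq
    using block_sum_update[of b e "\<lambda>t. v t i" "u i" n for i] assms by simp
qed


section \<open>A Baire argument on sequences of blocks\<close>

text \<open>Baire's theorem for the product of the discrete sets \<open>B t\<close>, applied to the
  preimages of the \<open>D i\<close> under the uniformly continuous \<open>f\<close>. If none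
  contained a cylinder, nested cylinders avoiding \<open>D 0\<close>, \<open>D 1\<close>, ... would
  shrink to a sequence whose image is in no \<open>D i\<close>.\<close>

lemma cylinder_within_closed:
  fixes B :: "nat \<Rightarrow> 'a set" and f :: "(nat \<Rightarrow> 'a) \<Rightarrow> 'b::metric_space" and D :: "nat \<Rightarrow> 'b set"
  assumes ne: "\<And>t. B t \<noteq> {}"
    and cont: "\<And>\<epsilon>. \<epsilon> > 0 \<Longrightarrow> \<exists>n. \<forall>v v'. (\<forall>t. v t \<in> B t) \<and> (\<forall>t. v' t \<in> B t) \<and> (\<forall>t<n. v t = v' t) \<longrightarrow> dist (f v) (f v') < \<epsilon>"
    and cl: "\<And>i. closed (D i)"
    and cover: "\<And>v. (\<And>t. v t \<in> B t) \<Longrightarrow> \<exists>i. f v \<in> D i"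
  obtains i v n where "\<And>t. v t \<in> B t"
    and "\<And>v'. \<lbrakk>\<And>t. v' t \<in> B t; \<And>t. t < n \<Longrightarrow> v' t = v t\<rbrakk> \<Longrightarrow> f v' \<in> D i"
proof (rule ccontr)
  note result = that
  assume neg: "\<not> thesis"
  have ex: "\<exists>v' n'. (\<forall>t. v' t \<in> B t) \<and> n < n' \<and> (\<forall>t<n. v' t = v t) \<and>
      (\<forall>v''. (\<forall>t. v'' t \<in> B t) \<and> (\<forall>t<n'. v'' t = v' t) \<longrightarrow> f v'' \<notin> D i)"
    if v: "\<forall>t. v t \<in> B t" for i v n
  proof -
    have "\<exists>v'. (\<forall>t. v' t \<in> B t) \<and> (\<forall>t<n. v' t = v t) \<and> f v' \<notin> D i"
    proof (rule ccontr)
      assume *: "\<not> ?thesis"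
      have thesis by (rule result[of v n i]) (use v * in blast)+
      then show False using neg by contradiction
    qed
    then obtain v' where v': "\<And>t. v' t \<in> B t" "\<And>t. t < n \<Longrightarrow> v' t = v t" "f v' \<notin> D i"
      by blast
    then obtain \<epsilon> where \<epsilon>: "\<epsilon> > 0" "ball (f v') \<epsilon> \<subseteq> - D i"
      using cl[of i] by (metis ComplI open_Compl open_contains_ball)
    obtain n0 where n0: "\<forall>v v'. (\<forall>t. v t \<in> B t) \<and> (\<forall>t. v' t \<in> B t) \<and> (\<forall>t<n0. v t = v' t) \<longrightarrow> dist (f v) (f v') < \<epsilon>"
      using cont[OF \<epsilon>(1)] by blast
    \<comment> \<open>\<open>n0\<close> keeps the image inside the ball that avoids
      \<open>D i\<close>; \<open>Suc n\<close> makes the cylinder lengths strictly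
      increasing.\<close>
    have "f v'' \<notin> D i" if "\<forall>t. v'' t \<in> B t" "\<forall>t<max n0 (Suc n). v'' t = v' t" for v''
    proof -
      have "dist (f v') (f v'') < \<epsilon>" using n0 v'(1) that by simp
      then show ?thesis using \<epsilon>(2) by auto
    qed
    then show ?thesis using v' by (intro exI[of _ v'] exI[of _ "max n0 (Suc n)"]) auto
  qed
  obtain v0 where v0: "\<forall>t. v0 t \<in> B t" using ne choice[of "\<lambda>t x. x \<in> B t"] by blast
  \<comment> \<open>A pair stands for the cylinder of the sequences agreeing with its first
    component below its second.\<close>
  let ?P = "\<lambda>(i::nat) (p :: (nat \<Rightarrow> 'a) \<times> nat). \<forall>t. fst p t \<in> B t"
  let ?Q = "\<lambda>i (p :: (nat \<Rightarrow> 'a) \<times> nat) (p' :: (nat \<Rightarrow> 'a) \<times> nat). snd p < snd p' \<and> (\<forall>t<snd p. fst p' t = fst p t) \<and>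
      (\<forall>v''. (\<forall>t. v'' t \<in> B t) \<and> (\<forall>t<snd p'. v'' t = fst p' t) \<longrightarrow> f v'' \<notin> D i)"
  have "\<exists>S. \<forall>i. ?P i (S i) \<and> ?Q i (S i) (S (Suc i))"
  proof (rule dependent_nat_choice)
    show "\<exists>p. ?P 0 p" using v0 by (intro exI[of _ "(v0, 0::nat)"]) simp
  next
    fix p and i :: nat assume "?P i p"
    from ex[OF this, where i = i and n = "snd p"]
    show "\<exists>p'. ?P (Suc i) p' \<and> ?Q i p p'" by auto
  qed
  then obtain S where S: "\<And>i. ?P i (S i)" "\<And>i. ?Q i (S i) (S (Suc i))" by blast
  define n where "n i = snd (S i)" for i
  define V where "V i = fst (S i)" for i
  have sm: "strict_mono n" using S(2) by (simp add: strict_mono_Suc_iff n_def)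
  have agree: "V j t = V i t" if "i \<le> j" "t < n i" for i j t
    using that
  proof (induction j rule: dec_induct)
    case (step j)
    have "t < n j" using step strict_mono_mono[OF sm] by (meson monoD order_less_le_trans)
    then show ?case using S(2)[of j] step by (simp add: n_def V_def)
  qed simp
  \<comment> \<open>Diagonal sequence: as \<open>t < n (Suc t)\<close>, the entry at
    \<open>t\<close> is frozen from stage \<open>Suc t\<close> on.\<close>
  define v where "v t = V (Suc t) t" for t
  have v: "v t \<in> B t" for t using S(1) by (simp add: v_def V_def)
  have nge: "t < n (Suc t)" for t using strict_mono_imp_increasing[OF sm, of "Suc t"] by simp
  have "v t = V i t" if "t < n i" for i t
    using agree[of i "Suc t" t] agree[of "Suc t" i t] that nge[of t] by (cases "i \<le> Suc t") (auto simp: v_def)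
  then have "f v \<notin> D i" for i using S(2)[of i] v by (auto simp: n_def V_def)
  then show False using cover[of v] v by blast
qed

text \<open>Some cover member is dense in the image of a cylinder. With \<open>m\<close> the
  dimension, a free block of length \<open>L\<close> there gives \<open>b ^ (m * L)\<close> points
  at mutual distance at least \<open>1 / b ^ e (Suc t)\<close>, so a packing of weight about
  \<open>b powr (m * L - s * e (Suc t))\<close>; by \<open>free\<close> this exponent is
  unbounded.\<close>

lemma packing_measure_block_vec:
  fixes B :: "nat \<Rightarrow> ('m::finite \<Rightarrow> nat) set" and A :: "(real^'m) set"
  assumes "b \<ge> 2" and e: "\<And>t. e t \<le> e (Suc t)" and "filterlim e at_top sequentially" and "0 \<le> s"
    and B: "\<And>t u i. u \<in> B t \<Longrightarrow> u i < b ^ (e (Suc t) - e t)" and ne: "\<And>t. B t \<noteq> {}"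
    and free: "\<And>Z n. \<exists>t\<ge>n. B t = {u. \<forall>i. u i < b ^ (e (Suc t) - e t)} \<and>
                 Z \<le> real CARD('m) * (real (e (Suc t)) - real (e t)) - s * real (e (Suc t))"
    and A: "\<And>v. (\<And>t. v t \<in> B t) \<Longrightarrow> block_vec b e v \<in> A"
    and "countable \<H>" and hyp: "\<And>H. H \<in> \<H> \<Longrightarrow> affine_hyperplane H"
  shows "packing_measure s (A - \<Union>\<H>) = top"
proof -
  have b: "b \<ge> 1" "real b > 1" using \<open>b \<ge> 2\<close> by auto
  have small: "\<exists>n. \<forall>t\<ge>n. c / real b ^ e t < \<epsilon>" if "\<epsilon> > 0" for c \<epsilon> :: real
  proof -
    have "filterlim (\<lambda>t. real b ^ e t) at_infinity sequentially"
      using b by (intro filterlim_compose[OF filterlim_realpow_sequentially_gt1 assms(3)]) simp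
    then have "((\<lambda>t. c / real b ^ e t) \<longlongrightarrow> 0) sequentially"
      by (intro tendsto_divide_0[OF tendsto_const])
    from order_tendstoD(2)[OF this that] show ?thesis by (simp add: eventually_sequentially)
  qed
  have cont: "\<exists>n. \<forall>v v'. (\<forall>t. v t \<in> B t) \<and> (\<forall>t. v' t \<in> B t) \<and> (\<forall>t<n. v t = v' t)
      \<longrightarrow> dist (block_vec b e v) (block_vec b e v') < \<epsilon>" if \<epsilon>: "\<epsilon> > 0" for \<epsilon> :: real
  proof -
    obtain n where "real CARD('m) / real b ^ e n < \<epsilon>" using small[OF \<epsilon>] by blast
    moreover have "dist (block_vec b e v) (block_vec b e v') \<le> real CARD('m) / real b ^ e n"
      if "\<forall>t. v t \<in> B t" "\<forall>t. v' t \<in> B t" "\<forall>t<n. v t = v' t" for v v'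
      using that B by (intro block_vec_agree b(1) e) auto
    ultimately show ?thesis by (intro exI[of _ n]) (auto intro: order_le_less_trans)
  qed
  have "(\<Sum>i. packing_premeasure s (C i)) = top" if C: "A - \<Union>\<H> \<subseteq> (\<Union>i. C i)" for C :: "nat \<Rightarrow> (real^'m) set"
  proof -
    \<comment> \<open>Closures provide the closed sets; with the hyperplanes adjoined,
      \<open>F\<close> covers every \<open>block_vec b e v\<close>, including those removed from
      \<open>A\<close>.\<close>
    define F where "F = range (\<lambda>i. closure (C i)) \<union> \<H>"
    define D where "D = from_nat_into F"
    have cF: "countable F" "F \<noteq> {}" using \<open>countable \<H>\<close> by (auto simp: F_def)
    have D: "D i \<in> F" for i unfolding D_def by (rule from_nat_into[OF cF(2)])
    have "closed H" if "H \<in> \<H>" for H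
      using hyp[OF that] by (auto simp: affine_hyperplane_def closed_hyperplane)
    then have "closed X" if "X \<in> F" for X using that by (auto simp: F_def)
    then have cl: "closed (D i)" for i using D .
    have cover: "\<exists>i. block_vec b e v \<in> D i" if "\<And>t. v t \<in> B t" for v
    proof -
      have "block_vec b e v \<in> \<Union>\<H> \<union> (\<Union>i. C i)" using A[OF that] C by blast
      also have "\<dots> \<subseteq> \<Union>F" unfolding F_def using closure_subset by fastforce
      finally obtain X where "X \<in> F" "block_vec b e v \<in> X" by blast
      then show ?thesis unfolding D_def using from_nat_into_surj[OF cF(1), of X] by metis
    qed
    have "\<exists>i v n. (\<forall>t. v t \<in> B t) \<and>
        (\<forall>v'. (\<forall>t. v' t \<in> B t) \<and> (\<forall>t<n. v' t = v t) \<longrightarrow> block_vec b e v' \<in> D i)"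
      by (rule cylinder_within_closed[of B "block_vec b e" D, OF ne cont cl cover]) blast+
    then obtain i v n where v: "\<And>t. v t \<in> B t"
      and cyl: "\<And>v'. \<lbrakk>\<And>t. v' t \<in> B t; \<And>t. t < n \<Longrightarrow> v' t = v t\<rbrakk> \<Longrightarrow> block_vec b e v' \<in> D i"
      by blast
    have pts: "block_vec b e (v(t := u)) \<in> D i"
        "block_vec b e (v(t := u)) = block_vec b e (v(t := \<lambda>_. 0)) + (\<chi> i. real (u i) / real b ^ e (Suc t))"
      if "t \<ge> n" "B t = {u. \<forall>i. u i < b ^ (e (Suc t) - e t)}" "\<And>i. u i < b ^ (e (Suc t) - e t)" for t u
    proof -
      show "block_vec b e (v(t := u)) \<in> D i" using v that by (intro cyl) auto
      show "block_vec b e (v(t := u)) = block_vec b e (v(t := \<lambda>_. 0)) + (\<chi> i. real (u i) / real b ^ e (Suc t))"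
        by (rule block_vec_update[OF b(1) e B[OF v] that(3)])
    qed
    \<comment> \<open>Changing one free digit block from 0 to 1 in coordinate \<open>j\<close> alone
      moves a point of the cylinder along the \<open>j\<close>-th axis; a hyperplane containing both
      points has \<open>a $ j = 0\<close>. Taking \<open>Z = 1\<close> in \<open>free\<close>
      ensures a block of positive length, in which 1 is admissible.\<close>
    have "D i \<notin> \<H>"
    proof
      assume "D i \<in> \<H>"
      then obtain a \<beta> where a: "a \<noteq> 0" "D i = {x. a \<bullet> x = \<beta>}"
        using hyp[of "D i"] by (auto simp: affine_hyperplane_def)
      obtain t where t: "t \<ge> n" "B t = {u. \<forall>i. u i < b ^ (e (Suc t) - e t)}"
        and big: "1 \<le> real CARD('m) * (real (e (Suc t)) - real (e t)) - s * real (e (Suc t))"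
        using free[of n 1] by blast
      have "0 \<le> s * real (e (Suc t))" using \<open>0 \<le> s\<close> by simp
      then have "e t \<noteq> e (Suc t)" using big by auto
      then have "b ^ (e (Suc t) - e t) > 1" using e[of t] \<open>b \<ge> 2\<close> by (intro one_less_power) auto
      moreover have "b ^ (e (Suc t) - e t) > 0" using b by simp
      ultimately have u: "(if P then 1 else 0) < b ^ (e (Suc t) - e t)" for P
        by (cases P) (simp_all only: if_True if_False)
      have "a $ j = 0" for j
      proof -
        have "a \<bullet> block_vec b e (v(t := \<lambda>_. 0)) = \<beta>"
          "a \<bullet> block_vec b e (v(t := \<lambda>i. if i = j then 1 else 0)) = \<beta>"
          using pts(1)[OF t, of "\<lambda>_. 0"] pts(1)[OF t, of "\<lambda>i. if i = j then 1 else 0"] a(2) u u[of False]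
          by auto
        then have "a \<bullet> (\<chi> i. real (if i = j then 1 else 0) / real b ^ e (Suc t)) = 0"
          using pts(2)[OF t, of "\<lambda>i. if i = j then 1 else 0"] u by (simp add: inner_add_right)
        also have "a \<bullet> (\<chi> i. real (if i = j then 1 else 0) / real b ^ e (Suc t)) = a $ j / real b ^ e (Suc t)"
          by (simp add: inner_vec_def if_distrib[of real] if_distrib[of "\<lambda>x. x / _"] if_distrib[of "\<lambda>x. _ * x"] cong: if_cong)
        finally show "a $ j = 0" using b by simp
      qed
      then show False using a(1) by (simp add: vec_eq_iff)
    qed
    then obtain j where j: "D i = closure (C j)" using D[of i] by (auto simp: F_def)
    have "packing_premeasure_at s \<delta> (C j) = top" if "\<delta> > 0" for \<delta>
    proof (rule ccontr)
      assume "packing_premeasure_at s \<delta> (C j) \<noteq> top"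
      then obtain z where z: "packing_premeasure_at s \<delta> (C j) < of_nat z"
        using ennreal_Ex_less_of_nat by (auto simp: less_top)
      obtain n' where n': "\<And>t. t \<ge> n' \<Longrightarrow> (1/4) / real b ^ e t < \<delta>" using small[OF \<open>\<delta> > 0\<close>] by blast
      \<comment> \<open>The weight of the packing below is
        \<open>b powr (m * L - s * e (Suc t)) * 2 powr (- s)\<close>, \<open>m\<close> being the
        dimension; this threshold makes it at least \<open>z + 1\<close>. The bound
        \<open>n'\<close> keeps the radius below \<delta>.\<close>
      obtain t where t: "t \<ge> max n n'" "B t = {u. \<forall>i. u i < b ^ (e (Suc t) - e t)}"
        and big: "log b (real (z + 1) * 2 powr s) \<le> real CARD('m) * (real (e (Suc t)) - real (e t)) - s * real (e (Suc t))"
        using free[of "max n n'"] by blast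
      have tn: "t \<ge> n" "t \<ge> n'" using t(1) by auto
      define L where "L = e (Suc t) - e t"
      \<comment> \<open>A quarter of the mesh of the grid, as
        \<open>packing_premeasure_at_ge\<close> asks for separation \<open>4 * r\<close>.\<close>
      define r where "r = (1/4) / real b ^ e (Suc t)"
      have I: "{u::'m \<Rightarrow> nat. \<forall>i. u i < b ^ L} = UNIV \<rightarrow>\<^sub>E {..<b ^ L}"
        by (auto simp: PiE_def Pi_def)
      have "ennreal (real (card (B t)) * (2 * r) powr s) \<le> packing_premeasure_at s \<delta> (C j)"
      proof (rule packing_premeasure_at_ge[where f = "\<lambda>u. block_vec b e (v(t := u))"])
        show "finite (B t)" unfolding t(2) L_def[symmetric] I by (intro finite_PiE) auto
        show "0 < r" "r \<le> \<delta>" using b n'[of "Suc t"] tn(2) by (auto simp: r_def intro: less_imp_le)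
        show "block_vec b e (v(t := u)) \<in> closure (C j)" if "u \<in> B t" for u
          using pts(1)[OF tn(1) t(2) B[OF that]] unfolding j .
        show "4 * r \<le> dist (block_vec b e (v(t := u))) (block_vec b e (v(t := u')))"
          if u: "u \<in> B t" "u' \<in> B t" "u \<noteq> u'" for u u'
        proof -
          obtain i where i: "u i \<noteq> u' i" using u(3) by auto
          have "4 * r \<le> \<bar>real (u i) - real (u' i)\<bar> / real b ^ e (Suc t)"
            using b i by (simp add: r_def divide_right_mono)
          also have "\<dots> = \<bar>(block_vec b e (v(t := u)) - block_vec b e (v(t := u'))) $ i\<bar>"
            unfolding pts(2)[OF tn(1) t(2) B[OF u(1)]] pts(2)[OF tn(1) t(2) B[OF u(2)]]
            by (simp add: diff_divide_distrib[symmetric])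
          also have "\<dots> \<le> dist (block_vec b e (v(t := u))) (block_vec b e (v(t := u')))"
            unfolding dist_norm by (rule component_le_norm_cart)
          finally show ?thesis .
        qed
      qed (rule \<open>0 \<le> s\<close>)
      moreover have "real z \<le> real (card (B t)) * (2 * r) powr s"
      proof -
        have "card (B t) = (b ^ L) ^ CARD('m)"
          unfolding t(2) L_def[symmetric] I by (subst card_PiE) auto
        then have c: "real (card (B t)) = real b powr (real CARD('m) * real L)"
          using b by (simp add: powr_realpow[symmetric] powr_powr mult.commute)
        have r2: "2 * r = real b powr (- real (e (Suc t))) * 2 powr (- 1)"
          using b by (simp add: r_def powr_minus powr_realpow field_simps)
        have "(2 * r) powr s = real b powr (- s * real (e (Suc t))) * 2 powr (- s)"
          by (simp only: r2 powr_mult powr_powr powr_ge_zero mult_minus_left mult_1 mult.commute[of s])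
        then have "real (card (B t)) * (2 * r) powr s
            = real b powr (real CARD('m) * real L - s * real (e (Suc t))) * 2 powr (- s)"
          using c by (simp add: powr_diff powr_minus field_simps)
        moreover have "real b powr log b (real (z + 1) * 2 powr s)
            \<le> real b powr (real CARD('m) * real L - s * real (e (Suc t)))"
          using big b e[of t] by (intro powr_mono) (auto simp: L_def of_nat_diff)
        moreover have "real b powr log b (real (z + 1) * 2 powr s) = real (z + 1) * 2 powr s"
          using b by (intro powr_log_cancel) auto
        ultimately have "real (z + 1) * 2 powr s * 2 powr (- s) \<le> real (card (B t)) * (2 * r) powr s"
          by (simp add: mult_right_mono)
        moreover have "real (z + 1) * 2 powr s * 2 powr (- s) = real (z + 1)"
          by (simp add: mult.assoc powr_add[symmetric])
        ultimately show ?thesis by linarith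
      qed
      ultimately show False
        using z by (metis ennreal_leI ennreal_of_nat_eq_real_of_nat leD order_trans)
    qed
    then have "packing_premeasure s (C j) = top" unfolding packing_premeasure_def by simp
    moreover have "(\<Sum>i\<in>{j}. packing_premeasure s (C i)) \<le> (\<Sum>i. packing_premeasure s (C i))"
      by (intro sum_le_suminf summableI) auto
    ultimately show ?thesis by (simp add: top_unique)
  qed
  then show ?thesis
    unfolding packing_measure_def by simp
qed


section \<open>Uniform approximation of the block expansions\<close>

text \<open>One half of the equivalence of norms, from the expansion in the standard basis; it
  reduces approximation in \<open>N\<close> to single coordinates. The summand 1 in the constant
  makes it positive.\<close>

lemma is_norm_le_coordinates:
  fixes N :: "real^'m \<Rightarrow> real"
  assumes "is_norm N"
  obtains C where "C > 0" and "\<And>x M. (\<And>i. \<bar>x $ i\<bar> \<le> M) \<Longrightarrow> N x \<le> C * M"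
proof
  have N: "N x \<ge> 0" "N (a *\<^sub>R x) = \<bar>a\<bar> * N x" "N (x + y) \<le> N x + N y" "N 0 = 0" for a x y
    using assms by (auto simp: is_norm_def)
  let ?C = "1 + (\<Sum>i\<in>UNIV. N (axis i 1))"
  show "?C > 0" using sum_nonneg[of UNIV "\<lambda>i. N (axis i 1)"] N(1) by (simp add: add_pos_nonneg)
  fix x :: "real^'m" and M :: real
  assume M: "\<And>i. \<bar>x $ i\<bar> \<le> M"
  then have "M \<ge> 0" by (meson abs_ge_zero order_trans)
  have sub: "N (sum f I) \<le> (\<Sum>i\<in>I. N (f i))" if "finite I" for f :: "'m \<Rightarrow> real^'m" and I
    using that
  proof (induction rule: finite_induct)
    case (insert i I)
    then show ?case using N(3)[of "f i" "sum f I"] by simp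
  qed (simp add: N)
  have "N x = N (\<Sum>i\<in>UNIV. x $ i *\<^sub>R axis i 1)"
    using basis_expansion[of x] by (simp add: scalar_mult_eq_scaleR)
  also have "\<dots> \<le> (\<Sum>i\<in>UNIV. \<bar>x $ i\<bar> * N (axis i 1))" using sub[of UNIV "\<lambda>i. x $ i *\<^sub>R axis i 1"] by (simp add: N)
  also have "\<dots> \<le> (\<Sum>i\<in>UNIV. M * N (axis i 1))" by (intro sum_mono mult_right_mono M N)
  also have "\<dots> \<le> ?C * M" using \<open>M \<ge> 0\<close> by (simp add: sum_distrib_left algebra_simps)
  finally show "N x \<le> ?C * M" .
qed

text \<open>For \<open>t mod K = j\<close> the denominator \<open>b ^ e t\<close> serves all
  \<open>Q\<close> from \<open>b ^ e t\<close> up to the next such denominator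
  \<open>b ^ e (t + K)\<close>. Its error is of order \<open>1 / b ^ (e (Suc t) - e t)\<close>, and
  by \<open>long\<close> this beats \<open>Q powr (- w)\<close> by any constant factor.\<close>

lemma block_vec_in_sing_set_base:
  fixes v :: "nat \<Rightarrow> 'm::finite \<Rightarrow> nat" and \<theta> :: "real^'m"
  assumes "is_norm N" and "b \<ge> 2" and e: "\<And>t. e t \<le> e (Suc t)" and lim: "filterlim e at_top sequentially"
    and v: "\<And>t i. v t i < b ^ (e (Suc t) - e t)" and "0 \<le> w" and "j < K"
    and forced: "\<And>t i. t mod K = j \<Longrightarrow> v t i = nat \<lfloor>frac (\<theta> $ i) * real b ^ (e (Suc t) - e t)\<rfloor>"
    and long: "\<And>Z. \<exists>t0. \<forall>t\<ge>t0. t mod K = j \<longrightarrow> Z \<le> real (e (Suc t)) - real (e t) - w * real (e (t + K))"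
  shows "block_vec b e v \<in> sing_set_base N b \<theta> w"
  unfolding sing_set_base_def approx_set_def
proof (intro CollectI allI impI)
  fix c :: real assume "c > 0"
  have b: "b \<ge> 1" "real b > 1" using \<open>b \<ge> 2\<close> by auto
  obtain C where C: "C > 0" "\<And>x M. (\<And>i. \<bar>x $ i\<bar> \<le> M) \<Longrightarrow> N x \<le> C * M"
    using is_norm_le_coordinates[OF \<open>is_norm N\<close>] by metis
  \<comment> \<open>The margin \<open>log b (C / c)\<close> absorbs the norm constant and the
    prescribed \<open>c\<close>.\<close>
  obtain t0 where t0: "\<And>t. \<lbrakk>t \<ge> t0; t mod K = j\<rbrakk> \<Longrightarrow> log b (C / c) \<le> real (e (Suc t)) - real (e t) - w * real (e (t + K))"
    using long[of "log b (C / c)"] by blast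
  \<comment> \<open>The denominator must be a power of \<open>b\<close> with positive
    exponent.\<close>
  obtain t1 where t1: "\<And>t. t \<ge> t1 \<Longrightarrow> e t \<ge> 1"
    using lim by (auto simp: filterlim_at_top eventually_sequentially)
  define a where "a i = e (j + K * (max t0 t1 + i))" for i
  have unbounded: "\<exists>i. Q < real b ^ a i" for Q
  proof -
    obtain n where n: "Q < real b ^ n" using real_arch_pow[OF b(2)] by blast
    obtain i where i: "\<And>t. t \<ge> i \<Longrightarrow> e t \<ge> n"
      using lim by (auto simp: filterlim_at_top eventually_sequentially)
    have "i \<le> 1 * i" by simp
    also have "\<dots> \<le> K * i" using \<open>j < K\<close> by (intro mult_right_mono) auto
    finally have "n \<le> a i" unfolding a_def distrib_left by (intro i trans_le_add2)
    then have "real b ^ n \<le> real b ^ a i" using b by (intro power_increasing) auto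
    then show ?thesis using n by (intro exI[of _ i]) simp
  qed
  show "\<exists>Q0. \<forall>Q\<ge>Q0. \<exists>q\<in>{int b ^ n |n. n \<ge> 1}. \<exists>p :: int^'m. 1 \<le> q \<and> of_int q \<le> Q \<and>
          N (of_int q *\<^sub>R block_vec b e v - (\<chi> i. of_int (p $ i)) - \<theta>) \<le> c * Q powr (- w)"
  proof (intro exI[of _ "real b ^ a 0"] allI impI)
    fix Q :: real assume Q: "real b ^ a 0 \<le> Q"
    obtain i where i: "Q < real b ^ a (Suc i)" "real b ^ a i \<le> Q"
    proof -
      \<comment> \<open>The least \<open>l\<close> is not 0 because \<open>Q\<close> is at least
        \<open>b ^ a 0\<close>, so its predecessor brackets \<open>Q\<close> from below.\<close>
      define l where "l = (LEAST l. Q < real b ^ a l)"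
      have l: "Q < real b ^ a l" unfolding l_def by (rule LeastI_ex[OF unbounded])
      moreover obtain i where "l = Suc i" using l Q by (cases l) auto
      moreover have "\<not> Q < real b ^ a i" using not_less_Least[of i "\<lambda>l. Q < real b ^ a l"] \<open>l = Suc i\<close> by (simp add: l_def)
      ultimately show thesis using that by auto
    qed
    define t where "t = j + K * (max t0 t1 + i)"
    have tm: "t mod K = j" using \<open>j < K\<close> by (simp add: t_def)
    have ge: "t \<ge> max t0 t1"
    proof -
      have "1 * max t0 t1 \<le> K * max t0 t1" using \<open>j < K\<close> by (intro mult_right_mono) auto
      then show ?thesis by (simp add: t_def distrib_left)
    qed
    have at: "a i = e t" "a (Suc i) = e (t + K)" by (simp_all add: a_def t_def add_ac)
    define L where "L = e (Suc t) - e t"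
    have "\<exists>p::int. \<bar>real b ^ e t * block_sum b e (\<lambda>t. v t l) - of_int p - \<theta> $ l\<bar> \<le> 1 / real b ^ L" for l
      unfolding L_def using b e v forced[OF tm] by (intro block_sum_approx) auto
    then obtain p where p: "\<And>l. \<bar>real b ^ e t * block_sum b e (\<lambda>t. v t l) - of_int (p l) - \<theta> $ l\<bar> \<le> 1 / real b ^ L"
      by metis
    have "N (of_int (int b ^ e t) *\<^sub>R block_vec b e v - (\<chi> i. of_int ((\<chi> l. p l) $ i)) - \<theta>) \<le> C * (1 / real b ^ L)"
      using p by (intro C(2)) (simp add: block_vec_def)
    also have "\<dots> \<le> c * Q powr (- w)"
    proof -
      have "C / c = real b powr log b (C / c)" using b C(1) \<open>c > 0\<close> by simp
      also have "\<dots> \<le> real b powr (real L - w * real (e (t + K)))"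
        using t0[of t] ge tm b e[of t] by (intro powr_mono) (auto simp: L_def of_nat_diff)
      also have "\<dots> = real b ^ L * (real b ^ e (t + K)) powr (- w)"
        using b by (simp add: powr_diff powr_realpow[symmetric] powr_powr powr_minus mult.commute field_simps)
      also have "\<dots> \<le> real b ^ L * Q powr (- w)"
      proof -
        have "0 < real b ^ e t" using b by simp
        then have "0 < Q" using i(2) unfolding at by linarith
        then show ?thesis
          using i(1) b \<open>0 \<le> w\<close> unfolding at by (intro mult_left_mono powr_mono2') auto
      qed
      finally show ?thesis using b \<open>c > 0\<close> by (simp add: field_simps)
    qed
    finally have "N (of_int (int b ^ e t) *\<^sub>R block_vec b e v - (\<chi> i. of_int ((\<chi> l. p l) $ i)) - \<theta>) \<le> c * Q powr (- w)" .
    moreover have "int b ^ e t \<in> {int b ^ n |n. n \<ge> 1}" using t1[of t] ge by auto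
    moreover have "1 \<le> int b ^ e t" using b by simp
    moreover have "of_int (int b ^ e t) \<le> Q" using i at by simp
    ultimately show "\<exists>q\<in>{int b ^ n |n. n \<ge> 1}. \<exists>p :: int^'m. 1 \<le> q \<and> of_int q \<le> Q \<and>
          N (of_int q *\<^sub>R block_vec b e v - (\<chi> i. of_int (p $ i)) - \<theta>) \<le> c * Q powr (- w)"
      by blast
  qed
qed


section \<open>The choice of the block lengths\<close>

lemma one_plus_inverse_power_le_exp:
  assumes "k \<ge> 1"
  shows "(1 + 1 / real k) ^ k \<le> exp 1"
proof -
  have "(1 + 1 / real k) ^ k \<le> exp (1 / real k) ^ k"
    by (intro power_mono exp_ge_add_one_self) simp
  also have "\<dots> = exp 1" using assms by (simp add: exp_of_nat_mult[symmetric])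
  finally show ?thesis .
qed

text \<open>The positions are first chosen as reals \<open>E t\<close>, growing by \<open>r\<close>
  over a copying block and by \<rho> over a whole period. Both requirements then become a positive
  multiple of \<open>E t\<close> or \<open>E (Suc t)\<close>, which outgrows the bounded loss from
  rounding down.\<close>

lemma block_lengths:
  fixes k :: nat and w s m :: real
  assumes "k \<ge> 1" and "0 \<le> w" and "0 \<le> s" and "m > 0" and "s < (1 - real k * exp 1 * w) * m"
  obtains e :: "nat \<Rightarrow> nat" where "\<And>t. e t \<le> e (Suc t)" and "filterlim e at_top sequentially"
    and "\<And>Z. \<exists>t0. \<forall>t\<ge>t0. t mod Suc k < k \<longrightarrow> Z \<le> real (e (Suc t)) - real (e t) - w * real (e (t + Suc k))"
    and "\<And>Z. \<exists>t0. \<forall>t\<ge>t0. t mod Suc k = k \<longrightarrow> Z \<le> m * (real (e (Suc t)) - real (e t)) - s * real (e (Suc t))"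
proof -
  \<comment> \<open>\<open>W\<close> is the solution of \<open>s = (1 - k e W) m\<close>.\<close>
  define W where "W = (1 - s / m) / (k * exp 1)"
  \<comment> \<open>Strictly between: \<open>w < w'\<close> makes the copying blocks long enough,
    \<open>w' < W\<close> leaves enough free digits. Also \<open>w' > 0\<close> even for
    \<open>w = 0\<close>, so \<rho> is a genuine positive number.\<close>
  define w' where "w' = (w + W) / 2"
  have "w < W" using assms by (simp add: W_def field_simps)
  then have w': "w < w'" "w' < W" "w' > 0" using assms(2) by (auto simp: w'_def)
  define \<rho> where "\<rho> = 1 / (k * w')"
  have kp: "real k > 0" using assms(1) by simp
  have \<rho>p: "\<rho> > 0" using kp w' by (simp add: \<rho>_def)
  have free: "m * (1 - exp 1 / \<rho>) > s" using w'(2,3) kp assms(4) by (simp add: W_def \<rho>_def field_simps)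
  then have "exp 1 < \<rho>"
    using \<rho>p assms(3,4) by (smt (verit) divide_less_eq_1 less_divide_eq_1 mult_nonneg_nonpos zero_less_mult_iff le_divide_eq_1_pos)
  define r where "r = 1 + 1 / real k"
  have r: "r > 1" "r ^ k \<le> exp 1" using one_plus_inverse_power_le_exp[OF assms(1)] kp by (auto simp: r_def)
  define E where "E t = \<rho> ^ (t div Suc k) * r ^ (t mod Suc k)" for t
  have Ep: "E t > 0" for t using \<rho>p r by (simp add: E_def)
  have E1: "E (Suc t) = r * E t" if "t mod Suc k < k" for t
    using that by (simp add: E_def div_Suc mod_Suc)
  \<comment> \<open>In period \<open>j\<close> the free block runs from
    \<open>\<rho> ^ j * r ^ k\<close> to \<open>\<rho> ^ (j + 1)\<close>; Euler's number enters
    through \<open>r ^ k \<le> exp 1\<close>.\<close>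
  have E2: "\<rho> * E t \<le> exp 1 * E (Suc t)" if "t mod Suc k = k" for t
    using that r(2) \<rho>p by (simp add: E_def div_Suc mod_Suc)
  have E3: "E (t + Suc k) = \<rho> * E t" for t
    using div_add_self2[of "Suc k" t] mod_add_self2[of t "Suc k"] by (simp only: E_def) simp
  \<comment> \<open>A common lower bound for the growth over copying and free blocks;
    \<open>c > 1\<close> forces \<open>E\<close> to infinity.\<close>
  define c where "c = min r (\<rho> / exp 1)"
  have c: "c > 1" using r \<open>exp 1 < \<rho>\<close> by (simp add: c_def)
  have Ec: "c * E t \<le> E (Suc t)" for t
  proof (cases "t mod Suc k < k")
    case True
    then show ?thesis using E1[OF True] Ep[of t] by (simp add: c_def mult_right_mono)
  next
    case False
    then have "t mod Suc k = k" by (metis mod_less_divisor zero_less_Suc less_Suc_eq)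
    then have "\<rho> / exp 1 * E t \<le> E (Suc t)" using E2 by (simp add: field_simps)
    moreover have "c * E t \<le> \<rho> / exp 1 * E t" using Ep[of t] by (intro mult_right_mono) (auto simp: c_def)
    ultimately show ?thesis by linarith
  qed
  have Eincr: "E t \<le> E (Suc t)" for t
    using Ec[of t] c Ep[of t] by (smt (verit) mult_le_cancel_right1)
  have Ebig: "\<exists>t0. \<forall>t\<ge>t0. Z \<le> E t" for Z
  proof -
    obtain t0 where "Z < c ^ t0" using real_arch_pow[OF c] by blast
    moreover have "c ^ t \<le> E t" for t
    proof (induction t)
      case (Suc t)
      then have "c * c ^ t \<le> c * E t" using c by (intro mult_left_mono) auto
      then show ?case using Ec[of t] by simp
    qed (simp add: E_def)
    ultimately have "Z \<le> E t0" by (meson less_le_trans less_imp_le)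
    then show ?thesis using lift_Suc_mono_le[of E, OF Eincr] by (meson order_trans)
  qed
  define e where "e t = nat \<lfloor>E t\<rfloor>" for t
  have e: "real (e t) \<le> E t" "E t - 1 < real (e t)" for t
    using Ep[of t] unfolding e_def by linarith+
  show thesis
  proof
    show "e t \<le> e (Suc t)" for t unfolding e_def by (intro nat_mono floor_mono Eincr)
    show "filterlim e at_top sequentially"
      unfolding filterlim_at_top eventually_sequentially
    proof
      fix Z :: nat
      obtain t0 where "\<forall>t\<ge>t0. real Z \<le> E t" using Ebig by blast
      then show "\<exists>t0. \<forall>t\<ge>t0. Z \<le> e t" unfolding e_def by (intro exI[of _ t0]) (auto intro: le_nat_floor)
    qed
    fix Z :: real
    \<comment> \<open>For a copying block,
      \<open>E (Suc t) - E t - w * E (t + Suc k) = \<kappa> * E t\<close>. Rounding costs at most 1,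
      hence \<open>Z + 1\<close> below.\<close>
    define \<kappa> where "\<kappa> = 1 / k - w * \<rho>"
    have "\<kappa> > 0" using w' kp by (simp add: \<kappa>_def \<rho>_def field_simps)
    obtain t0 where t0: "\<And>t. t \<ge> t0 \<Longrightarrow> (Z + 1) / \<kappa> \<le> E t" using Ebig by blast
    have "Z \<le> real (e (Suc t)) - real (e t) - w * real (e (t + Suc k))"
      if "t \<ge> t0" "t mod Suc k < k" for t
    proof -
      have "w * real (e (t + Suc k)) \<le> w * (\<rho> * E t)" using e(1)[of "t + Suc k"] E3 assms(2) by (simp add: mult_left_mono)
      moreover have "E (Suc t) = E t + E t / k" using E1[OF that(2)] by (simp add: r_def distrib_right)
      moreover have "Z + 1 \<le> \<kappa> * E t" using t0[OF that(1)] \<open>\<kappa> > 0\<close> by (simp add: field_simps)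
      moreover have "\<kappa> * E t = E t / k - w * (\<rho> * E t)" by (simp add: \<kappa>_def algebra_simps)
      ultimately show ?thesis using e[of "Suc t"] e[of t] by linarith
    qed
    then show "\<exists>t0. \<forall>t\<ge>t0. t mod Suc k < k \<longrightarrow> Z \<le> real (e (Suc t)) - real (e t) - w * real (e (t + Suc k))"
      by blast
    \<comment> \<open>For a free block, \<open>m * (E (Suc t) - E t) - s * E (Suc t)\<close> is at
      least \<open>\<mu> * E (Suc t)\<close>; here rounding costs at most \<open>m\<close>.\<close>
    define \<mu> where "\<mu> = m * (1 - exp 1 / \<rho>) - s"
    have "\<mu> > 0" using free by (simp add: \<mu>_def)
    obtain t1 where t1: "\<And>t. t \<ge> t1 \<Longrightarrow> (Z + m) / \<mu> \<le> E t" using Ebig by blast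
    have "Z \<le> m * (real (e (Suc t)) - real (e t)) - s * real (e (Suc t))"
      if "t \<ge> t1" "t mod Suc k = k" for t
    proof -
      have "E t \<le> exp 1 / \<rho> * E (Suc t)" using E2[OF that(2)] \<rho>p by (simp add: field_simps)
      then have "E (Suc t) - 1 - exp 1 / \<rho> * E (Suc t) \<le> real (e (Suc t)) - real (e t)"
        using e[of "Suc t"] e[of t] by linarith
      then have "m * (E (Suc t) - 1 - exp 1 / \<rho> * E (Suc t)) \<le> m * (real (e (Suc t)) - real (e t))"
        using assms(4) by (intro mult_left_mono) auto
      moreover have "s * real (e (Suc t)) \<le> s * E (Suc t)" using e(1) assms(3) by (intro mult_left_mono) auto
      moreover have "Z + m \<le> \<mu> * E (Suc t)" using t1[of "Suc t"] that(1) \<open>\<mu> > 0\<close> by (simp add: field_simps)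
      moreover have "\<mu> * E (Suc t) = m * (E (Suc t) - 1 - exp 1 / \<rho> * E (Suc t)) + m - s * E (Suc t)"
        by (simp add: \<mu>_def algebra_simps)
      ultimately show ?thesis by linarith
    qed
    then show "\<exists>t0. \<forall>t\<ge>t0. t mod Suc k = k \<longrightarrow> Z \<le> m * (real (e (Suc t)) - real (e t)) - s * real (e (Suc t))"
      by blast
  qed
qed

section \<open>Lower bound for the packing dimension of the \<open>b\<close>-ary sets\<close>

lemma packing_dim_sing_set_base_ge:
  fixes N :: "real^'m \<Rightarrow> real" and \<theta> :: "nat \<Rightarrow> real^'m"
  assumes "is_norm N" and "k \<ge> 1" and "b \<ge> 2" and "countable \<H>"
    and hyp: "\<And>H. H \<in> \<H> \<Longrightarrow> affine_hyperplane H" and "0 \<le> w"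
  shows "ereal ((1 - real k * exp 1 * w) * real CARD('m))
           \<le> packing_dim ((\<Inter>t\<in>\<theta> ` {1..k}. sing_set_base N b t w) - \<Union>\<H>)"
proof (rule packing_dim_ge)
  fix s :: real assume s: "0 \<le> s" "s < (1 - real k * exp 1 * w) * real CARD('m)"
  obtain e where e: "\<And>t. e t \<le> e (Suc t)" and lim: "filterlim e at_top sequentially"
    and long: "\<And>Z. \<exists>t0. \<forall>t\<ge>t0. t mod Suc k < k \<longrightarrow> Z \<le> real (e (Suc t)) - real (e t) - w * real (e (t + Suc k))"
    and free: "\<And>Z. \<exists>t0. \<forall>t\<ge>t0. t mod Suc k = k \<longrightarrow> Z \<le> real CARD('m) * (real (e (Suc t)) - real (e t)) - s * real (e (Suc t))"
    using block_lengths[OF assms(2,6) s(1) _ s(2)] by (metis of_nat_0_less_iff zero_less_card_finite)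
  have b: "b \<ge> 1" using assms(3) by simp
  \<comment> \<open>Residues modulo \<open>Suc k\<close> start at 0 and the indices of \<theta> at
    1: residue \<open>i - 1\<close> copies \<open>\<theta> i\<close>, and residue \<open>k\<close>
    is free.\<close>
  define B :: "nat \<Rightarrow> ('m \<Rightarrow> nat) set" where
    "B t = (if t mod Suc k = k then {u. \<forall>i. u i < b ^ (e (Suc t) - e t)}
            else {\<lambda>i. nat \<lfloor>frac (\<theta> (Suc (t mod Suc k)) $ i) * real b ^ (e (Suc t) - e t)\<rfloor>})" for t
  have fl: "nat \<lfloor>frac x * real b ^ L\<rfloor> < b ^ L" for x :: real and L
  proof -
    have "frac x * real b ^ L < 1 * real b ^ L" using b by (intro mult_strict_right_mono frac_lt_1) auto
    then have "\<lfloor>frac x * real b ^ L\<rfloor> < int (b ^ L)" by (simp add: floor_less_iff)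
    then show ?thesis using b by (subst nat_less_iff) auto
  qed
  have B: "u i < b ^ (e (Suc t) - e t)" if "u \<in> B t" for u t i
    using that fl by (auto simp: B_def split: if_splits)
  have "packing_measure s ((\<Inter>t\<in>\<theta> ` {1..k}. sing_set_base N b t w) - \<Union>\<H>) = top"
  proof (rule packing_measure_block_vec[where B = B])
    show "B t \<noteq> {}" for t using b by (auto simp: B_def intro: exI[of _ "\<lambda>_. 0"])
    fix Z :: real and n :: nat
    obtain t0 where t0: "\<And>t. \<lbrakk>t \<ge> t0; t mod Suc k = k\<rbrakk> \<Longrightarrow> Z \<le> real CARD('m) * (real (e (Suc t)) - real (e t)) - s * real (e (Suc t))"
      using free[of Z] by blast
    \<comment> \<open>The free block of period \<open>max n t0\<close>, hence beyond both
      \<open>n\<close> and \<open>t0\<close>.\<close>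
    let ?t = "k + Suc k * max n t0"
    have "?t mod Suc k = k" "?t \<ge> max n t0" by (subst mod_mult_self2) auto
    then show "\<exists>t\<ge>n. B t = {u. \<forall>i. u i < b ^ (e (Suc t) - e t)} \<and>
        Z \<le> real CARD('m) * (real (e (Suc t)) - real (e t)) - s * real (e (Suc t))"
      using t0[of ?t] by (intro exI[of _ ?t]) (simp add: B_def)
  next
    fix v assume v: "\<And>t. v t \<in> B t"
    have "block_vec b e v \<in> sing_set_base N b (\<theta> i) w" if i: "i \<in> {1..k}" for i
    proof (rule block_vec_in_sing_set_base[where K = "Suc k" and j = "i - 1"])
      show "v t l < b ^ (e (Suc t) - e t)" for t l using B[OF v] .
      show "v t l = nat \<lfloor>frac (\<theta> i $ l) * real b ^ (e (Suc t) - e t)\<rfloor>" if "t mod Suc k = i - 1" for t l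
      proof -
        have "Suc (t mod Suc k) = i" "t mod Suc k \<noteq> k" using that i by auto
        then show ?thesis using v[of t] by (simp add: B_def)
      qed
      have "i - 1 < k" using i by auto
      then show "\<exists>t0. \<forall>t\<ge>t0. t mod Suc k = i - 1 \<longrightarrow> Z \<le> real (e (Suc t)) - real (e t) - w * real (e (t + Suc k))" for Z
        using long[of Z] by metis
      show "i - 1 < Suc k" using i by auto
    qed (use assms e lim in auto)
    then show "block_vec b e v \<in> (\<Inter>t\<in>\<theta> ` {1..k}. sing_set_base N b t w)" by blast
  qed (use assms e lim s B in auto)
  then show "packing_measure s ((\<Inter>t\<in>\<theta> ` {1..k}. sing_set_base N b t w) - \<Union>\<H>) \<noteq> 0" by simp
qed

lemma sing_set_base_subset: "sing_set_base N b \<theta> w \<subseteq> sing_set N \<theta> w"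
  unfolding sing_set_base_def sing_set_def approx_set_def by blast

theorem theorem2p5:
  fixes N :: "real^'m \<Rightarrow> real"
    and k b :: nat
    and \<theta> :: "nat \<Rightarrow> real^'m"
    and \<Theta> :: "(real^'m) set"
    and \<H> :: "(real^'m) set set"
    and T :: "(real^'m) set"
  assumes "is_norm N"
    and "k \<ge> 1"
    and "b \<ge> 2"
    and "\<Theta> = \<theta> ` {1..k}"
    and "countable \<H>"
    and "\<forall>H\<in>\<H>. affine_hyperplane H"
    and "T = \<Union>\<H>"
  shows "(\<forall>w::real. 0 \<le> w \<and> w < 1 \<longrightarrow>
            packing_dim ((\<Inter>t\<in>\<Theta>. sing_set N t w) - T)
              \<ge> packing_dim ((\<Inter>t\<in>\<Theta>. sing_set_base N b t w) - T) \<and>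
            packing_dim ((\<Inter>t\<in>\<Theta>. sing_set_base N b t w) - T)
              \<ge> ereal ((1 - real k * exp 1 * w) * real CARD('m))) \<and>
         (real k < real CARD('m) / exp 1 \<longrightarrow>
            packing_dim ((\<Inter>t\<in>\<Theta>. sing_set N t (1 / real CARD('m))) - T)
              \<ge> packing_dim ((\<Inter>t\<in>\<Theta>. sing_set_base N b t (1 / real CARD('m))) - T) \<and>
            packing_dim ((\<Inter>t\<in>\<Theta>. sing_set_base N b t (1 / real CARD('m))) - T) > 0)"
proof -
  have sub: "packing_dim ((\<Inter>t\<in>\<Theta>. sing_set_base N b t w) - T)
      \<le> packing_dim ((\<Inter>t\<in>\<Theta>. sing_set N t w) - T)" for w
    using sing_set_base_subset by (intro packing_dim_mono) blast
  have lower: "ereal ((1 - real k * exp 1 * w) * real CARD('m))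
      \<le> packing_dim ((\<Inter>t\<in>\<Theta>. sing_set_base N b t w) - T)" if "0 \<le> w" for w
    using packing_dim_sing_set_base_ge[of N k b \<H> w \<theta>] assms that by simp
  have "0 < packing_dim ((\<Inter>t\<in>\<Theta>. sing_set_base N b t (1 / real CARD('m))) - T)"
    if "real k < real CARD('m) / exp 1"
  proof -
    \<comment> \<open>At \<open>w = 1 / m\<close>, with \<open>m\<close> the dimension, the lower
      bound equals \<open>m - k * exp 1\<close>.\<close>
    have "0 < (1 - real k * exp 1 * (1 / real CARD('m))) * real CARD('m)"
      using that by (simp add: field_simps)
    then have "0 < ereal ((1 - real k * exp 1 * (1 / real CARD('m))) * real CARD('m))" by simp
    also have "\<dots> \<le> packing_dim ((\<Inter>t\<in>\<Theta>. sing_set_base N b t (1 / real CARD('m))) - T)"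
      by (rule lower) simp
    finally show ?thesis .
  qed
  then show ?thesis using sub lower by blast
qed

end
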